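(* Let $d\geq1$, $n\geq1$, $q$ be integers and suppose that $\boldsymbol{\psi}=(\psi_1,\dots,\psi_q):(\mathbb{R}^d)^n\to\mathbb{R}^q$ satisfies: (a) $\psi_k:(\mathbb{R}^d)^n\to\mathbb{R}$ is symmetric and continuous for every $k\in\{1,\dots,q\}$; (b) $\boldsymbol{\psi}(\mathbf{x}_1,\dots,\mathbf{x}_n)=\boldsymbol{\psi}(\mathbf{x}_1',\dots,\mathbf{x}_n')$ if and only if there exists some $\sigma\in S_n$ such that $\mathbf{x}_{\sigma(i)}=\mathbf{x}_i'$ for all $i\in\{1,\dots,n\}$; (c) $\boldsymbol{\psi}(\mathbf{x}_1,\dots,\mathbf{x}_n)\neq0$ for all $\mathbf{x}_1,\dots,\mathbf{x}_n\in\mathbb{R}^d$. Then, with $m=\left(\frac{n(n-1)}{2}\cdot(d-1)+1\right)\cdot q$, there exist anti-symmetric and continuous functions $\eta_1,\dots,\eta_m:(\mathbb{R}^d)^n\to\mathbb{R}$ such that $\boldsymbol{\eta}=(\eta_1,\dots,\eta_m):(\mathbb{R}^d)^n\to\mathbb{R}^m$ satisfies: (i) $\boldsymbol{\eta}(\mathbf{x}_1,\dots,\mathbf{x}_n)=0$ if and only if $\mathbf{x}_i=\mathbf{x}_j$ for some $i,j\in\{1,\dots,n\}$ with $i\neq j$; (ii) if $\boldsymbol{\eta}(\mathbf{x}_1,\dots,\mathbf{x}_n)=\boldsymbol{\eta}(\mathbf{x}_1',\dots,\mathbf{x}_n')\neq0$, then there exists a permutation $\sigma\in S_n$ such that $(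\mathbf{x}_1',\dots,\mathbf{x}_n')=(\mathbf{x}_{\sigma(1)},\dots,\mathbf{x}_{\sigma(n)})$.
   Context: $S_n$ is the group of all permutations of $\{1,\dots,n\}$ and $(-1)^\sigma$ is the signature of $\sigma$. A function $f:(\mathbb{R}^d)^n\to\mathbb{R}$ is symmetric if $f(\mathbf{x}_{\sigma(1)},\dots,\mathbf{x}_{\sigma(n)})=f(\mathbf{x}_1,\dots,\mathbf{x}_n)$ for all $\sigma\in S_n$ and all $\mathbf{x}_1,\dots,\mathbf{x}_n\in\mathbb{R}^d$, and anti-symmetric if $f(\mathbf{x}_{\sigma(1)},\dots,\mathbf{x}_{\sigma(n)})=(-1)^\sigma f(\mathbf{x}_1,\dots,\mathbf{x}_n)$ for all such $\sigma$ and $\mathbf{x}_1,\dots,\mathbf{x}_n$. *)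

theory Defs
  imports "HOL-Analysis.Analysis"
begin

(* A point of (R^d)^n is x :: real^'d^'n with x $ i the i-th vector; the finite type 'n
   plays the role of the index set {1..n} and the permutations of UNIV :: 'n set that of S_n. *)

definition symmetric_function :: "(real^'d^'n \<Rightarrow> real) \<Rightarrow> bool" where
  "symmetric_function f \<longleftrightarrow>
     (\<forall>\<sigma> x. \<sigma> permutes UNIV \<longrightarrow> f (\<chi> i. x $ \<sigma> i) = f x)"

definition antisymmetric_function :: "(real^'d^'n \<Rightarrow> real) \<Rightarrow> bool" where
  "antisymmetric_function f \<longleftrightarrow>
     (\<forall>\<sigma> x. \<sigma> permutes UNIV \<longrightarrow> f (\<chi> i. x $ \<sigma> i) = of_int (sign \<sigma>) * f x)"

end

theory Submission
  imports Defs
begin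

text \<open>
  Let \<open>n\<close> be the number of vectors and \<open>d\<close> their dimension. Multiplying the given invariants
  by Vandermonde products would determine them only up to a common nonzero factor. Instead,
  for \<open>n \<ge> 2\<close> the given invariants serve only to bound their number: they are injective on an
  open set of configurations, so \<open>q \<ge> n d\<close> by invariance of domain
  (\<open>separating_invariants_card\<close>). It then suffices to find \<open>n d\<close> suitable functions for each
  of \<open>L = n (n - 1) / 2 \<cdot> (d - 1) + 1\<close> linear projections.

  Take the projections \<open>v \<mapsto> \<langle>a, v\<rangle>\<close> along \<open>L\<close> points \<open>a\<close> of the moment curve. A nonzero vector is
  orthogonal to at most \<open>d - 1\<close> of them, so pairwise distinct vectors have pairwise distinct
  images under at least one projection (\<open>exists_inj_moment_proj\<close>). Fix a projection and let
  \<open>D\<close> be the product of all \<open>\<bar>\<langle>a, x\<^sub>i\<rangle> - \<langle>a, x\<^sub>j\<rangle>\<bar>\<close> with \<open>i \<noteq> j\<close>. Sort the vectors by their projection;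
  let \<open>s\<close> be the sign of the sorting permutation. The coordinates of the sorted list are symmetric, and
  they jump only where two projections agree, that is, where \<open>D\<close> vanishes. Hence \<open>s D\<close> and its
  products with these coordinates are continuous and antisymmetric
  (\<open>continuous_sorted_coord\<close>, \<open>antisymmetric_sorted_coord\<close>).

  These are \<open>n d + 1\<close> functions, one too many. But \<open>D\<close> is strictly increasing in the largest
  projection, so the first \<open>n - 1\<close> sorted vectors together with \<open>D\<close> determine the projection of
  the last one. One coordinate of the last vector can therefore be omitted, and the remaining
  \<open>n d\<close> functions determine the sorted list wherever \<open>D \<noteq> 0\<close> (\<open>sorted_coord_determines\<close>).

  For \<open>n = 1\<close> every function is antisymmetric, and the given invariants themselves are as required.
\<close>

section \<open>Ranks and orientation of a finite family of reals\<close>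

text \<open>The position of \<^term>\<open>y i\<close> when the values of \<^term>\<open>y\<close> are listed in increasing order,
  counted from 0; in general, the number of strictly smaller values.\<close>

definition value_rank :: "('n::finite \<Rightarrow> real) \<Rightarrow> 'n \<Rightarrow> nat" where
  "value_rank y i = card {j. y j < y i}"

text \<open>The product of \<open>\<bar>y i - y j\<bar>\<close> over all ordered pairs with \<open>i \<noteq> j\<close>, that is,
  the absolute value of the discriminant.\<close>

definition gap_prod :: "('n::finite \<Rightarrow> real) \<Rightarrow> real" where
  "gap_prod y = (\<Prod>(i, j) \<in> {(i, j). i \<noteq> j}. \<bar>y i - y j\<bar>)"

text \<open>The sign of the permutation that sorts \<^term>\<open>y\<close>, relative to the reference
  enumeration \<^term>\<open>e\<close> of the index type. It is meaningful only for injective \<^term>\<open>y\<close>.\<close>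

definition orient :: "('n::finite \<Rightarrow> nat) \<Rightarrow> ('n \<Rightarrow> real) \<Rightarrow> real" where
  "orient e y = of_int (sign (inv_into UNIV e \<circ> value_rank y))"

lemma gap_prod_nonneg: "gap_prod y \<ge> 0"
  unfolding gap_prod_def by (intro prod_nonneg) auto

lemma gap_prod_eq_0_iff: "gap_prod (y :: 'n::finite \<Rightarrow> real) = 0 \<longleftrightarrow> \<not> inj y"
proof -
  have "finite {(i, j :: 'n). i \<noteq> j}" by simp
  then show ?thesis
    unfolding gap_prod_def by (auto simp: prod_zero_iff inj_def)
qed

lemma gap_prod_permute:
  assumes "bij (\<sigma> :: 'n::finite \<Rightarrow> 'n)"
  shows "gap_prod (y \<circ> \<sigma>) = gap_prod y"
proof -
  have "bij_betw (map_prod \<sigma> \<sigma>) {(i, j). i \<noteq> j} {(i, j). i \<noteq> j}"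
  proof (rule bij_betw_imageI)
    show "inj_on (map_prod \<sigma> \<sigma>) {(i, j). i \<noteq> j}"
      using assms by (auto simp: inj_on_def bij_def)
    show "map_prod \<sigma> \<sigma> ` {(i, j). i \<noteq> j} = {(i, j). i \<noteq> j}"
    proof (intro equalityI subsetI)
      fix p :: "'n \<times> 'n" assume p: "p \<in> {(i, j). i \<noteq> j}"
      then obtain i j where ij: "p = (\<sigma> i, \<sigma> j)"
        using assms by (metis bij_pointE surj_pair)
      with p show "p \<in> map_prod \<sigma> \<sigma> ` {(i, j). i \<noteq> j}"
        by (auto intro!: image_eqI[of _ _ "(i, j)"])
    qed (use assms in \<open>auto simp: bij_def inj_eq\<close>)
  qed
  then show ?thesis
    unfolding gap_prod_def
    by (subst prod.reindex_bij_betw[symmetric, of "map_prod \<sigma> \<sigma>" "{(i, j). i \<noteq> j}"])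
       (auto simp: case_prod_unfold intro!: prod.cong)
qed

lemma value_rank_permute:
  assumes "bij (\<sigma> :: 'n::finite \<Rightarrow> 'n)"
  shows "value_rank (y \<circ> \<sigma>) i = value_rank y (\<sigma> i)"
proof -
  have "bij_betw \<sigma> {j. y (\<sigma> j) < y (\<sigma> i)} {j. y j < y (\<sigma> i)}"
  proof (rule bij_betw_imageI)
    show "inj_on \<sigma> {j. y (\<sigma> j) < y (\<sigma> i)}"
      using assms by (auto simp: bij_def inj_on_def)
    show "\<sigma> ` {j. y (\<sigma> j) < y (\<sigma> i)} = {j. y j < y (\<sigma> i)}"
      using assms by (auto simp: image_iff) (metis bij_pointE)
  qed
  then show ?thesis
    unfolding value_rank_def by (simp add: bij_betw_same_card)
qed

lemma value_rank_less: "value_rank (y :: 'n::finite \<Rightarrow> real) i < CARD('n)"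
  unfolding value_rank_def by (rule psubset_card_mono) auto

lemma value_rank_strict_mono: "y i < y j \<Longrightarrow> value_rank y i < value_rank (y :: 'n::finite \<Rightarrow> real) j"
  unfolding value_rank_def by (rule psubset_card_mono) auto

lemma value_rank_less_imp_less:
  assumes "value_rank y i < value_rank (y :: 'n::finite \<Rightarrow> real) j"
  shows "y i < y j"
proof (rule ccontr)
  assume "\<not> y i < y j"
  then have "value_rank y j \<le> value_rank y i"
    unfolding value_rank_def by (intro card_mono) auto
  with assms show False by simp
qed

lemma value_rank_bij:
  assumes "inj (y :: 'n::finite \<Rightarrow> real)"
  shows "bij_betw (value_rank y) UNIV {0..<CARD('n)}"
proof -
  have "inj (value_rank y)"
  proof (rule injI)
    fix i j assume "value_rank y i = value_rank y j"
    then have "y i = y j"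
      using value_rank_strict_mono[of y i j] value_rank_strict_mono[of y j i] by linarith
    then show "i = j" using assms by (simp add: inj_eq)
  qed
  moreover from this have "range (value_rank y) = {0..<CARD('n)}"
    by (intro card_subset_eq) (auto simp: value_rank_less card_image)
  ultimately show ?thesis by (simp add: bij_betw_def)
qed

lemma abs_orient [simp]: "\<bar>orient e y\<bar> = 1"
  by (simp add: orient_def sign_def)

lemma orient_nonzero [simp]: "orient e y \<noteq> 0"
  by (simp add: orient_def sign_def)

lemma bij_permutes_UNIV: "bij p \<longleftrightarrow> p permutes UNIV"
  by (auto intro: bij_imp_permutes permutes_bij)

lemma bij_permutation: "bij (p :: 'n::finite \<Rightarrow> 'n) \<Longrightarrow> permutation p"
  by (rule permutes_imp_permutation[of UNIV]) (simp_all add: bij_permutes_UNIV)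

lemma orient_permute:
  fixes y :: "'n::finite \<Rightarrow> real"
  assumes e: "bij_betw e UNIV {0..<CARD('n)}" and y: "inj y" and \<sigma>: "bij \<sigma>"
  shows "orient e (y \<circ> \<sigma>) = of_int (sign \<sigma>) * orient e y"
proof -
  have "bij (inv_into UNIV e \<circ> value_rank y)"
    using bij_betw_trans[OF value_rank_bij[OF y] bij_betw_inv_into[OF e]] .
  moreover have "value_rank (y \<circ> \<sigma>) = value_rank y \<circ> \<sigma>"
    using value_rank_permute[OF \<sigma>] by auto
  ultimately show ?thesis
    using \<sigma> by (simp add: orient_def sign_compose bij_permutation flip: comp_assoc)
qed

text \<open>Raising the largest value increases every gap to it. This is what makes one real
  coordinate redundant later on.\<close>

lemma gap_prod_raise_max:
  fixes y y' :: "'n::finite \<Rightarrow> real"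
  assumes card: "CARD('n) \<ge> 2" and y: "inj y"
    and agree: "\<And>j. j \<noteq> i \<Longrightarrow> y' j = y j"
    and max: "\<And>j. j \<noteq> i \<Longrightarrow> y j < y i" and less: "y i < y' i"
  shows "gap_prod y < gap_prod y'"
proof -
  have "\<exists>j. j \<noteq> i"
  proof (rule ccontr)
    assume "\<nexists>j. j \<noteq> i"
    then have "(UNIV :: 'n set) = {i}" by auto
    then have "CARD('n) = 1" by (metis card.empty card.insert empty_iff finite.emptyI One_nat_def)
    with card show False by simp
  qed
  then obtain j where j: "j \<noteq> i" by blast
  have le: "\<bar>y a - y b\<bar> \<le> \<bar>y' a - y' b\<bar>" if "a \<noteq> b" for a b
    using that agree[of a] agree[of b] max[of a] max[of b] less by (cases "a = i"; cases "b = i") auto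
  have pos: "0 < \<bar>y a - y b\<bar>" if "a \<noteq> b" for a b
    using that y by (auto simp: inj_eq)
  show ?thesis
    unfolding gap_prod_def
  proof (rule prod_mono_strict[where i = "(i, j)"])
    show "(i, j) \<in> {(i, j). i \<noteq> j}" using j by auto
    show "(case (i, j) of (i, j) \<Rightarrow> \<bar>y i - y j\<bar>) < (case (i, j) of (i, j) \<Rightarrow> \<bar>y' i - y' j\<bar>)"
      using max[OF j] agree[OF j] less by simp
  qed (use le pos in \<open>fastforce simp: less_le_trans\<close>)+
qed

lemma gap_prod_determines_max:
  fixes y y' :: "'n::finite \<Rightarrow> real"
  assumes card: "CARD('n) \<ge> 2" and y: "inj y" "inj y'"
    and agree: "\<And>j. j \<noteq> i \<Longrightarrow> y' j = y j"
    and max: "\<And>j. j \<noteq> i \<Longrightarrow> y j < y i" "\<And>j. j \<noteq> i \<Longrightarrow> y' j < y' i"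
    and gap: "gap_prod y = gap_prod y'"
  shows "y i = y' i"
proof (rule linorder_cases)
  assume "y i < y' i"
  then show ?thesis using gap_prod_raise_max[of y i y'] assms by simp
next
  assume "y' i < y i"
  then show ?thesis using gap_prod_raise_max[of y' i y] assms by simp
qed

text \<open>Ranks are locally constant where \<^term>\<open>Y x\<close> is injective, and elsewhere the factor
  \<^const>\<open>gap_prod\<close> vanishes. So a bounded dependence on the ranks does not spoil continuity.\<close>

lemma continuous_gap_prod_mult:
  fixes Y :: "'a::topological_space \<Rightarrow> 'n::finite \<Rightarrow> real" and F :: "('n \<Rightarrow> nat) \<Rightarrow> 'a \<Rightarrow> real"
  assumes Y: "\<And>i. continuous_on UNIV (\<lambda>x. Y x i)"
    and F: "\<And>\<rho>. continuous_on UNIV (F \<rho>)"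
    and B: "continuous_on UNIV B" "\<And>\<rho> x. \<bar>F \<rho> x\<bar> \<le> B x"
  shows "continuous_on UNIV (\<lambda>x. gap_prod (Y x) * F (value_rank (Y x)) x)"
proof -
  have gap: "continuous_on UNIV (\<lambda>x. gap_prod (Y x))"
    unfolding gap_prod_def case_prod_unfold by (intro continuous_intros Y)
  have tendsto: "(f \<longlongrightarrow> f a) (at a)" if "continuous_on UNIV f" for f :: "'a \<Rightarrow> real" and a
    using that by (simp add: continuous_on_def)
  have "((\<lambda>x. gap_prod (Y x) * F (value_rank (Y x)) x) \<longlongrightarrow> gap_prod (Y a) * F (value_rank (Y a)) a) (at a)" for a
  proof (cases "inj (Y a)")
    case True
    have ev_less: "\<forall>\<^sub>F x in at a. Y x i < Y x j" if "Y a i < Y a j" for i j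
      using order_tendstoD(2)[OF tendsto[OF continuous_on_diff[OF Y[of i] Y[of j]], of a], of 0] that
      by simp
    have "\<forall>\<^sub>F x in at a. Y x i < Y x j \<longleftrightarrow> Y a i < Y a j" for i j
    proof (cases "Y a i" "Y a j" rule: linorder_cases)
      case less
      from \<open>Y a i < Y a j\<close> ev_less[of i j] show ?thesis by (auto elim: eventually_mono)
    next
      case equal
      then have "i = j" using True by (simp add: inj_eq)
      then show ?thesis by simp
    next
      case greater
      with ev_less[of j i] show ?thesis by (auto elim: eventually_mono)
    qed
    then have "\<forall>\<^sub>F x in at a. \<forall>i j. Y x i < Y x j \<longleftrightarrow> Y a i < Y a j"
      by (intro eventually_all_finite)
    then have ev: "\<forall>\<^sub>F x in at a. gap_prod (Y x) * F (value_rank (Y a)) x = gap_prod (Y x) * F (value_rank (Y x)) x"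
      by eventually_elim (simp add: value_rank_def[abs_def])
    have "((\<lambda>x. gap_prod (Y x) * F (value_rank (Y a)) x) \<longlongrightarrow> gap_prod (Y a) * F (value_rank (Y a)) a) (at a)"
      by (intro tendsto_mult tendsto gap F)
    with ev show ?thesis by (rule Lim_transform_eventually[rotated])
  next
    case False
    then have 0: "gap_prod (Y a) = 0" by (simp add: gap_prod_eq_0_iff)
    have "((\<lambda>x. gap_prod (Y x) * B x) \<longlongrightarrow> gap_prod (Y a) * B a) (at a)"
      by (intro tendsto_mult tendsto gap B)
    then have "((\<lambda>x. gap_prod (Y x) * B x) \<longlongrightarrow> 0) (at a)" by (simp add: 0)
    then have "((\<lambda>x. gap_prod (Y x) * F (value_rank (Y x)) x) \<longlongrightarrow> 0) (at a)"
      by (rule Lim_null_comparison[rotated])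
         (simp add: abs_mult gap_prod_nonneg mult_left_mono B)
    then show ?thesis by (simp add: 0)
  qed
  then show ?thesis by (simp add: continuous_on_def)
qed


section \<open>Projections along the moment curve\<close>

text \<open>The inner products of the vectors \<open>x $ i\<close> with the point of the moment curve at
  parameter \<^term>\<open>t\<close>; \<^term>\<open>h\<close> enumerates the coordinates, so that the point has
  coordinate \<open>t ^ h c\<close> in direction \<open>c\<close>.\<close>

definition moment_proj :: "('d::finite \<Rightarrow> nat) \<Rightarrow> nat \<Rightarrow> real^'d^'n \<Rightarrow> 'n::finite \<Rightarrow> real" where
  "moment_proj h t x i = (\<Sum>c\<in>UNIV. real t ^ h c * x $ i $ c)"

lemma moment_proj_permute: "moment_proj h t (\<chi> i. x $ \<sigma> i) = moment_proj h t x \<circ> \<sigma>"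
  by (auto simp: moment_proj_def)

lemma card_moment_roots:
  fixes v :: "real^'d::finite"
  assumes h: "bij_betw h UNIV {0..<CARD('d)}" and v: "v \<noteq> 0"
  shows "card {t \<in> T. (\<Sum>c\<in>UNIV. real t ^ h c * v $ c) = 0} \<le> CARD('d) - 1"
proof -
  define a where "a k = v $ inv_into UNIV h k" for k
  have inj: "inj h" using h by (simp add: bij_betw_def)
  obtain c where c: "v $ c \<noteq> 0" using v by (auto simp: vec_eq_iff)
  have "h c \<in> {0..<CARD('d)}" using h by (metis bij_betwE UNIV_I)
  then have hc: "a (h c) \<noteq> 0" "h c \<le> CARD('d) - 1"
    using c inj by (auto simp: a_def)
  have ivl: "{..CARD('d) - 1} = {0..<CARD('d)}"
    unfolding atLeast0LessThan lessThan_Suc_atMost[symmetric] by simp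
  have sum: "(\<Sum>c\<in>UNIV. real t ^ h c * v $ c) = (\<Sum>k\<le>CARD('d) - 1. a k * real t ^ k)" for t
    unfolding ivl using inj
    by (subst sum.reindex_bij_betw[OF h, symmetric]) (simp add: a_def mult.commute)
  let ?R = "{z. (\<Sum>k\<le>CARD('d) - 1. a k * z ^ k) = 0}"
  have R: "finite ?R" "card ?R \<le> CARD('d) - 1"
    using polyfun_rootbound[where c = a and n = "CARD('d) - 1"] hc by blast+
  have "card {t \<in> T. (\<Sum>c\<in>UNIV. real t ^ h c * v $ c) = 0} \<le> card ?R"
    using R by (intro card_inj_on_le[of real]) (auto simp: sum)
  with R show ?thesis by linarith
qed

text \<open>Each of the \<open>n (n - 1) / 2\<close> pairs of distinct vectors is identified by at most
  \<open>d - 1\<close> parameters, so among one more parameter than this excludes some projection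
  separates all vectors.\<close>

lemma exists_inj_moment_proj:
  fixes x :: "real^'d::finite^'n::finite"
  assumes h: "bij_betw h UNIV {0..<CARD('d)}" and x: "inj (($) x)"
  shows "\<exists>t\<in>{1..CARD('n) * (CARD('n) - 1) div 2 * (CARD('d) - 1) + 1}. inj (moment_proj h t x)"
proof (rule ccontr)
  let ?T = "{1..CARD('n) * (CARD('n) - 1) div 2 * (CARD('d) - 1) + 1}"
  let ?P = "{A. A \<subseteq> (UNIV :: 'n set) \<and> card A = 2}"
  define bad where "bad A = {t \<in> ?T. \<exists>i j. A = {i, j} \<and> i \<noteq> j \<and> moment_proj h t x i = moment_proj h t x j}" for A
  assume "\<not> ?thesis"
  then have not_inj: "\<not> inj (moment_proj h t x)" if "t \<in> ?T" for t
    using that by blast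
  have "?T \<subseteq> (\<Union>A\<in>?P. bad A)"
  proof
    fix t assume t: "t \<in> ?T"
    then obtain i j where "i \<noteq> j" "moment_proj h t x i = moment_proj h t x j"
      using not_inj unfolding inj_def by blast
    with t have "t \<in> bad {i, j}" "{i, j} \<in> ?P" unfolding bad_def by auto
    then show "t \<in> (\<Union>A\<in>?P. bad A)" by blast
  qed
  then have "card ?T \<le> card (\<Union>A\<in>?P. bad A)"
    by (intro card_mono) (auto simp: bad_def)
  also have "\<dots> \<le> (\<Sum>A\<in>?P. card (bad A))"
    by (intro card_UN_le) simp
  also have "\<dots> \<le> (\<Sum>A\<in>?P. CARD('d) - 1)"
  proof (rule sum_mono)
    fix A assume "A \<in> ?P"
    then obtain i j where ij: "A = {i, j}" "i \<noteq> j" by (auto simp: card_2_iff)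
    then have "x $ i - x $ j \<noteq> 0" using x by (auto simp: inj_eq)
    from card_moment_roots[OF h this, of ?T]
    have "card {t \<in> ?T. moment_proj h t x i = moment_proj h t x j} \<le> CARD('d) - 1"
      by (simp add: moment_proj_def right_diff_distrib sum_subtractf)
    moreover have "bad A = {t \<in> ?T. moment_proj h t x i = moment_proj h t x j}"
      unfolding bad_def using ij by (auto simp: doubleton_eq_iff)
    ultimately show "card (bad A) \<le> CARD('d) - 1" by simp
  qed
  also have "\<dots> = CARD('n) * (CARD('n) - 1) div 2 * (CARD('d) - 1)"
    using n_subsets[of "UNIV :: 'n set" 2] by (simp add: choose_two)
  finally show False by simp
qed

section \<open>The antisymmetric functions\<close>

text \<open>For the parameter \<open>t\<close> and the position \<open>k\<close>, the coordinate \<open>c\<close> of the vector in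
  position \<open>k\<close> of the list sorted by the projection at \<open>t\<close>, multiplied by the signed
  \<^const>\<open>gap_prod\<close>. The coordinate \<open>c\<^sub>0\<close> of the last vector is replaced by the constant 1,
  so that the signed \<^const>\<open>gap_prod\<close> itself is among these functions.\<close>

definition sorted_coord ::
  "('n::finite \<Rightarrow> nat) \<Rightarrow> ('d::finite \<Rightarrow> nat) \<Rightarrow> 'd \<Rightarrow> nat \<Rightarrow> nat \<Rightarrow> 'd \<Rightarrow> real^'d^'n \<Rightarrow> real" where
  "sorted_coord e h c\<^sub>0 t k c x =
     gap_prod (moment_proj h t x) * (orient e (moment_proj h t x) *
       (if k = CARD('n) - 1 \<and> c = c\<^sub>0 then 1
        else \<Sum>i\<in>UNIV. if value_rank (moment_proj h t x) i = k then x $ i $ c else 0))"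

lemma sorted_coord_not_inj:
  "\<not> inj (moment_proj h t x) \<Longrightarrow> sorted_coord e h c\<^sub>0 t k c x = 0"
  by (simp add: sorted_coord_def gap_prod_eq_0_iff)

lemma antisymmetric_sorted_coord:
  fixes e :: "'n::finite \<Rightarrow> nat" and h :: "'d::finite \<Rightarrow> nat"
  assumes e: "bij_betw e UNIV {0..<CARD('n)}"
  shows "antisymmetric_function (sorted_coord e h c\<^sub>0 t k c :: real^'d^'n \<Rightarrow> real)"
  unfolding antisymmetric_function_def
proof (intro allI impI)
  fix \<sigma> :: "'n \<Rightarrow> 'n" and x :: "real^'d^'n"
  assume "\<sigma> permutes UNIV"
  then have \<sigma>: "bij \<sigma>" by (simp add: bij_permutes_UNIV)
  let ?y = "moment_proj h t x"
  show "sorted_coord e h c\<^sub>0 t k c (\<chi> i. x $ \<sigma> i) = of_int (sign \<sigma>) * sorted_coord e h c\<^sub>0 t k c x"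
  proof (cases "inj ?y")
    case True
    have "(\<Sum>i\<in>UNIV. if value_rank ?y (\<sigma> i) = k then x $ \<sigma> i $ c else 0) =
          (\<Sum>i\<in>UNIV. if value_rank ?y i = k then x $ i $ c else 0)"
      by (rule sum.reindex_bij_betw[OF \<sigma>])
    then show ?thesis
      using orient_permute[OF e True \<sigma>]
      by (simp add: sorted_coord_def moment_proj_permute gap_prod_permute[OF \<sigma>]
          value_rank_permute[OF \<sigma>] cong: if_cong)
  next
    case False
    then have "gap_prod ?y = 0" by (simp add: gap_prod_eq_0_iff)
    then show ?thesis
      by (simp add: sorted_coord_def moment_proj_permute gap_prod_permute[OF \<sigma>])
  qed
qed

lemma continuous_sorted_coord:
  "continuous_on UNIV (sorted_coord e h c\<^sub>0 t k c :: real^'d::finite^'n::finite \<Rightarrow> real)"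
proof -
  define F where "F \<rho> x = of_int (sign (inv_into UNIV e \<circ> \<rho>)) *
       (if k = CARD('n) - 1 \<and> c = c\<^sub>0 then 1 else \<Sum>i\<in>UNIV. if \<rho> i = k then x $ i $ c else 0)"
    for \<rho> and x :: "real^'d^'n"
  have "continuous_on UNIV (\<lambda>x. gap_prod (moment_proj h t x) * F (value_rank (moment_proj h t x)) x)"
  proof (rule continuous_gap_prod_mult)
    show "continuous_on UNIV (\<lambda>x :: real^'d^'n. moment_proj h t x i)" for i
      unfolding moment_proj_def by (intro continuous_intros)
    have "continuous_on UNIV (\<lambda>x :: real^'d^'n. if \<rho> i = k then x $ i $ c else 0)" for \<rho> :: "'n \<Rightarrow> nat" and i
      by (cases "\<rho> i = k") (auto intro!: continuous_intros)
    then show "continuous_on UNIV (F \<rho>)" for \<rho>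
      unfolding F_def
      by (cases "k = CARD('n) - 1 \<and> c = c\<^sub>0") (auto intro!: continuous_intros)
    show "continuous_on UNIV (\<lambda>x :: real^'d^'n. 1 + (\<Sum>i\<in>UNIV. \<bar>x $ i $ c\<bar>))"
      by (intro continuous_intros)
    show "\<bar>F \<rho> x\<bar> \<le> 1 + (\<Sum>i\<in>UNIV. \<bar>x $ i $ c\<bar>)" for \<rho> x
    proof -
      have "\<bar>\<Sum>i\<in>UNIV. if \<rho> i = k then x $ i $ c else 0\<bar> \<le> (\<Sum>i\<in>UNIV. \<bar>x $ i $ c\<bar>)"
        by (rule order_trans[OF sum_abs]) (auto intro: sum_mono)
      moreover have "0 \<le> (\<Sum>i\<in>UNIV. \<bar>x $ i $ c\<bar>)" by (simp add: sum_nonneg)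
      ultimately show ?thesis by (simp add: F_def abs_mult sign_def)
    qed
  qed
  moreover have eq: "(\<lambda>x. gap_prod (moment_proj h t x) * F (value_rank (moment_proj h t x)) x) =
      sorted_coord e h c\<^sub>0 t k c"
    by (simp add: fun_eq_iff sorted_coord_def F_def orient_def)
  ultimately show ?thesis by (simp only: eq)
qed

lemma sum_at_value_rank:
  assumes "inj (y :: 'n::finite \<Rightarrow> real)"
  shows "(\<Sum>j\<in>UNIV. if value_rank y j = value_rank y i then g j else 0) = (g i :: real)"
proof -
  have "inj (value_rank y)" using value_rank_bij[OF assms] by (simp add: bij_betw_def)
  then show ?thesis by (simp add: inj_eq)
qed

text \<open>The values at \<open>x\<close> give the list of vectors sorted by the projection, except for one
  coordinate of the last vector. That coordinate follows from the \<^const>\<open>gap_prod\<close>, which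
  determines the largest projection once the others are known; for \<open>t \<ge> 1\<close> every coordinate
  enters the projection with a nonzero factor.\<close>

lemma sorted_coord_determines:
  fixes x x' :: "real^'d::finite^'n::finite"
  assumes card: "CARD('n) \<ge> 2" and t: "t \<ge> 1"
    and eq: "\<And>k c. k < CARD('n) \<Longrightarrow> sorted_coord e h c\<^sub>0 t k c x = sorted_coord e h c\<^sub>0 t k c x'"
    and inj: "inj (moment_proj h t x)"
  shows "\<exists>\<sigma>. \<sigma> permutes UNIV \<and> x' = (\<chi> i. x $ \<sigma> i)"
proof -
  let ?y = "moment_proj h t x" and ?y' = "moment_proj h t x'" and ?n = "CARD('n)"
  \<comment> \<open>The value at \<open>k = n - 1\<close>, \<open>c = c\<^sub>0\<close>; its absolute value is the gap product.\<close>
  define U where "U = gap_prod ?y * orient e ?y"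
  have n: "?n - 1 < ?n" using card by simp
  have U': "U = gap_prod ?y' * orient e ?y'"
    using eq[OF n, of c\<^sub>0] by (simp add: sorted_coord_def U_def)
  have U0: "U \<noteq> 0" using inj by (simp add: U_def gap_prod_eq_0_iff)
  then have inj': "inj ?y'" using U' gap_prod_eq_0_iff[of ?y'] by auto
  have "\<bar>U\<bar> = gap_prod ?y" by (simp add: U_def abs_mult gap_prod_nonneg)
  moreover have "\<bar>U\<bar> = gap_prod ?y'" by (simp add: U' abs_mult gap_prod_nonneg)
  ultimately have gap: "gap_prod ?y = gap_prod ?y'" by simp
  note bij = value_rank_bij[OF inj] and bij' = value_rank_bij[OF inj']
  \<comment> \<open>Match the vectors of the two configurations that have equal rank.\<close>
  define \<sigma> where "\<sigma> = inv_into UNIV (value_rank ?y) \<circ> value_rank ?y'"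
  have \<sigma>: "bij \<sigma>"
    unfolding \<sigma>_def by (rule bij_betw_trans[OF bij' bij_betw_inv_into[OF bij]])
  have rank: "value_rank ?y (\<sigma> i) = value_rank ?y' i" for i
    using bij_betw_inv_into_right[OF bij, of "value_rank ?y' i"] by (simp add: \<sigma>_def value_rank_less)
  have coord: "x $ \<sigma> i $ c = x' $ i $ c" if "\<not> (value_rank ?y' i = ?n - 1 \<and> c = c\<^sub>0)" for i c
  proof -
    let ?S = "\<lambda>y x. \<Sum>j\<in>UNIV. if value_rank y j = value_rank ?y' i then x $ j $ c else 0"
    have "U * ?S ?y x = U * ?S ?y' x'"
      using eq[OF value_rank_less[of ?y' i], of c] that unfolding U_def
      by (subst (2) U'[unfolded U_def]) (auto simp: sorted_coord_def mult.assoc)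
    then have "?S ?y x = ?S ?y' x'" using U0 by simp
    moreover have "?S ?y x = x $ \<sigma> i $ c"
      using sum_at_value_rank[OF inj, of "\<sigma> i" "\<lambda>j. x $ j $ c"] by (simp add: rank)
    moreover have "?S ?y' x' = x' $ i $ c"
      by (rule sum_at_value_rank[OF inj'])
    ultimately show ?thesis by simp
  qed
  obtain i\<^sub>0 where i\<^sub>0: "value_rank ?y' i\<^sub>0 = ?n - 1"
    using bij' n by (metis bij_betw_iff_bijections atLeastLessThan_iff le0)
  have last: "value_rank ?y' i < value_rank ?y' i\<^sub>0" if "i \<noteq> i\<^sub>0" for i
  proof -
    have "value_rank ?y' i \<noteq> value_rank ?y' i\<^sub>0"
      using that bij' by (auto simp: bij_betw_def inj_eq)
    then show ?thesis using i\<^sub>0 value_rank_less[of ?y' i] by linarith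
  qed
  let ?z = "?y \<circ> \<sigma>"
  have z_eq: "?z i\<^sub>0 = ?y' i\<^sub>0"
  proof (rule gap_prod_determines_max[OF card])
    show "inj ?z" using inj \<sigma> by (simp add: inj_compose bij_is_inj)
    show "gap_prod ?z = gap_prod ?y'" using gap by (simp add: gap_prod_permute[OF \<sigma>])
    fix j assume j: "j \<noteq> i\<^sub>0"
    with last[OF j] i\<^sub>0 show "?y' j = ?z j"
      by (simp add: moment_proj_def coord)
    have zr: "value_rank ?z = value_rank ?y'" using rank by (simp add: fun_eq_iff value_rank_permute[OF \<sigma>])
    show "?y' j < ?y' i\<^sub>0"
      using value_rank_less_imp_less[OF last[OF j]] .
    show "?z j < ?z i\<^sub>0"
      using last[OF j] by (intro value_rank_less_imp_less) (simp only: zr)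
  qed (fact inj')
  have "x $ \<sigma> i $ c = x' $ i $ c" for i c
  proof (cases "i = i\<^sub>0 \<and> c = c\<^sub>0")
    case True
    let ?f = "\<lambda>v c. real t ^ h c * v $ c"
    have "(\<Sum>c\<in>UNIV. ?f (x $ \<sigma> i\<^sub>0) c) = (\<Sum>c\<in>UNIV. ?f (x' $ i\<^sub>0) c)"
      using z_eq by (simp add: moment_proj_def)
    moreover have "(\<Sum>c\<in>UNIV - {c\<^sub>0}. ?f (x $ \<sigma> i\<^sub>0) c) = (\<Sum>c\<in>UNIV - {c\<^sub>0}. ?f (x' $ i\<^sub>0) c)"
      by (rule sum.cong) (simp_all add: coord)
    ultimately have "?f (x $ \<sigma> i\<^sub>0) c\<^sub>0 = ?f (x' $ i\<^sub>0) c\<^sub>0"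
      by (simp add: sum.remove[of UNIV c\<^sub>0])
    then show ?thesis using True t by simp
  next
    case False
    with last[of i] i\<^sub>0 show ?thesis by (intro coord) auto
  qed
  then have "x' = (\<chi> i. x $ \<sigma> i)" by (simp add: vec_eq_iff)
  with \<sigma> show ?thesis by (auto simp: bij_permutes_UNIV)
qed

section \<open>The number of separating invariants\<close>

text \<open>On the box where the \<open>c\<^sub>0\<close>-coordinates of the vectors lie in disjoint intervals, no
  nontrivial permutation maps a point of the box into the box. So the invariants are injective
  there, and invariance of domain applies.\<close>

lemma separating_invariants_card:
  fixes \<psi> :: "nat \<Rightarrow> real^'d::finite^'n::finite \<Rightarrow> real"
  assumes cont: "\<And>k. k \<in> {1..q} \<Longrightarrow> continuous_on UNIV (\<psi> k)"
    and sep: "\<And>x x'. (\<And>k. k \<in> {1..q} \<Longrightarrow> \<psi> k x = \<psi> k x') \<Longrightarrow>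
                \<exists>\<sigma>. \<sigma> permutes UNIV \<and> (\<forall>i. x $ \<sigma> i = x' $ i)"
  shows "CARD('n) * CARD('d) \<le> q"
proof (rule ccontr)
  assume "\<not> ?thesis"
  then have less: "q < DIM(real^'d^'n)" by simp
  then obtain b where b: "b ` {1..q} \<subseteq> (Basis :: (real^'d^'n) set)" "inj_on b {1..q}"
    using card_le_inj[of "{1..q}" "Basis :: (real^'d^'n) set"] by auto
  define G where "G x = (\<Sum>k\<in>{1..q}. \<psi> k x *\<^sub>R b k)" for x
  have G_coord: "G x \<bullet> b k = \<psi> k x" if k: "k \<in> {1..q}" for x k
  proof -
    have "\<psi> j x * (b j \<bullet> b k) = (if j = k then \<psi> j x else 0)" if "j \<in> {1..q}" for j
      using b that k inner_Basis[of "b j" "b k"] by (auto simp: inj_on_eq_iff image_subset_iff)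
    then have "(\<Sum>j\<in>{1..q}. \<psi> j x * (b j \<bullet> b k)) = (\<Sum>j\<in>{1..q}. if j = k then \<psi> j x else 0)"
      by (intro sum.cong) auto
    then show ?thesis using k by (simp add: G_def inner_sum_left)
  qed
  obtain e :: "'n \<Rightarrow> nat" where e: "bij_betw e UNIV {0..<CARD('n)}"
    using ex_bij_betw_finite_nat[of "UNIV :: 'n set"] by auto
  obtain c\<^sub>0 :: 'd where True by blast
  define V where "V = {x :: real^'d^'n. \<forall>i. x $ i \<in> {v. v $ c\<^sub>0 \<in> {real (e i)<..<real (e i) + 1}}}"
  have "open {v :: real^'d. v $ c\<^sub>0 \<in> {a<..<b}}" for a b
    using open_vimage_vec_nth[of "{a<..<b}" c\<^sub>0] by (simp add: vimage_def)
  then have "open V" unfolding V_def by (intro open_vector_box) auto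
  moreover have "(\<chi> i c. real (e i) + 1 / 2) \<in> V" by (simp add: V_def)
  moreover have "inj_on G V"
  proof (rule inj_onI)
    fix x x' assume V: "x \<in> V" "x' \<in> V" and "G x = G x'"
    then obtain \<sigma> where \<sigma>: "\<And>i. x $ \<sigma> i = x' $ i"
      using sep[of x x'] G_coord by metis
    have "\<sigma> i = i" for i
    proof -
      have "real (e (\<sigma> i)) < x' $ i $ c\<^sub>0" "x' $ i $ c\<^sub>0 < real (e (\<sigma> i)) + 1"
        using V(1) \<sigma>[of i] by (auto simp: V_def dest: spec[of _ "\<sigma> i"])
      moreover have "real (e i) < x' $ i $ c\<^sub>0" "x' $ i $ c\<^sub>0 < real (e i) + 1"
        using V(2) by (auto simp: V_def)
      ultimately have "e (\<sigma> i) = e i" by linarith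
      with e show ?thesis by (simp add: bij_betw_def inj_eq)
    qed
    with \<sigma> show "x = x'" by (simp add: vec_eq_iff)
  qed
  moreover have "continuous_on V G"
    unfolding G_def using cont by (intro continuous_intros) (auto intro: continuous_on_subset)
  ultimately have "open (G ` V)" "G ` V \<noteq> {}"
    by (auto intro: invariance_of_domain)
  moreover have "G ` V \<subseteq> span (b ` {1..q})"
    by (auto simp: G_def intro: span_sum span_scale span_base)
  ultimately have "interior (span (b ` {1..q})) \<noteq> {}"
    using interior_maximal[of "G ` V" "span (b ` {1..q})"] by blast
  moreover have "dim (span (b ` {1..q})) \<le> q"
    using dim_le_card'[of "b ` {1..q}"] card_image_le[of "{1..q}" b] by simp
  ultimately show False
    using less empty_interior_lowdim[of "span (b ` {1..q})"] by linarith
qed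

section \<open>Separation by antisymmetric functions\<close>

theorem proposition2p3:
  fixes \<psi> :: "nat \<Rightarrow> real^'d^'n \<Rightarrow> real" and q m :: nat
  assumes sym: "\<forall>k\<in>{1..q}. symmetric_function (\<psi> k) \<and> continuous_on UNIV (\<psi> k)"
    and sep: "\<forall>x x'. (\<forall>k\<in>{1..q}. \<psi> k x = \<psi> k x') \<longleftrightarrow>
                (\<exists>\<sigma>. \<sigma> permutes UNIV \<and> (\<forall>i. x $ \<sigma> i = x' $ i))"
    and nonzero: "\<forall>x. \<not> (\<forall>k\<in>{1..q}. \<psi> k x = 0)"
    and m: "m = (CARD('n) * (CARD('n) - 1) div 2 * (CARD('d) - 1) + 1) * q"
  shows "\<exists>\<eta> :: nat \<Rightarrow> real^'d^'n \<Rightarrow> real.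
           (\<forall>k\<in>{1..m}. antisymmetric_function (\<eta> k) \<and> continuous_on UNIV (\<eta> k)) \<and>
           (\<forall>x. (\<forall>k\<in>{1..m}. \<eta> k x = 0) \<longleftrightarrow> (\<exists>i j. i \<noteq> j \<and> x $ i = x $ j)) \<and>
           (\<forall>x x'. (\<forall>k\<in>{1..m}. \<eta> k x = \<eta> k x') \<and> \<not> (\<forall>k\<in>{1..m}. \<eta> k x = 0) \<longrightarrow>
              (\<exists>\<sigma>. \<sigma> permutes UNIV \<and> x' = (\<chi> i. x $ \<sigma> i)))"
proof (cases "CARD('n) = 1")
  case True
  then have mq: "m = q" by (simp add: m)
  obtain a :: 'n where a: "UNIV = {a}" using True by (metis card_1_singletonE)
  have single: "i = j" for i j :: 'n using a by (metis UNIV_I singletonD)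
  have id: "\<sigma> = id" for \<sigma> :: "'n \<Rightarrow> 'n" using single by auto
  have "antisymmetric_function (\<psi> k)" for k
    unfolding antisymmetric_function_def
  proof (intro allI impI)
    fix \<sigma> :: "'n \<Rightarrow> 'n" and x :: "real^'d^'n"
    show "\<psi> k (\<chi> i. x $ \<sigma> i) = of_int (sign \<sigma>) * \<psi> k x"
      unfolding id[of \<sigma>] by simp
  qed
  moreover have "\<exists>\<sigma>. \<sigma> permutes UNIV \<and> x' = (\<chi> i. x $ \<sigma> i)"
    if "\<forall>k\<in>{1..q}. \<psi> k x = \<psi> k x'" for x x'
    using sep that by (simp add: vec_eq_iff) metis
  ultimately show ?thesis
    using sym nonzero single unfolding mq by (intro exI[of _ \<psi>]) auto
next
  case False
  then have card: "CARD('n) \<ge> 2" using zero_less_card_finite[where ?'a = 'n] by linarith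
  let ?L = "CARD('n) * (CARD('n) - 1) div 2 * (CARD('d) - 1) + 1"
  obtain e :: "'n \<Rightarrow> nat" where e: "bij_betw e UNIV {0..<CARD('n)}"
    using ex_bij_betw_finite_nat[of "UNIV :: 'n set"] by auto
  obtain h :: "'d \<Rightarrow> nat" where h: "bij_betw h UNIV {0..<CARD('d)}"
    using ex_bij_betw_finite_nat[of "UNIV :: 'd set"] by auto
  obtain c\<^sub>0 :: 'd where True by blast
  define S :: "nat \<times> nat \<times> 'd \<Rightarrow> real^'d^'n \<Rightarrow> real"
    where "S = (\<lambda>(t, k, c). sorted_coord e h c\<^sub>0 t k c)"
  define I where "I = {1..?L} \<times> {..<CARD('n)} \<times> (UNIV :: 'd set)"
  have "CARD('n) * CARD('d) \<le> q"
    by (rule separating_invariants_card[of q \<psi>]) (use sym sep in blast)+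
  then have "?L * (CARD('n) * CARD('d)) \<le> m"
    unfolding m by (rule mult_le_mono2)
  then have "card I \<le> card {1..m}"
    by (simp add: I_def card_cartesian_product)
  then obtain g where g: "g ` I \<subseteq> {1..m}" "inj_on g I"
    using card_le_inj[of I "{1..m}"] by (auto simp: I_def)
  \<comment> \<open>Since \<open>q\<close> may exceed \<open>n d\<close>, the family is padded with zero functions.\<close>
  define \<eta> where "\<eta> k = (if k \<in> g ` I then S (inv_into I g k) else (\<lambda>x. 0))" for k
  have \<eta>_g: "\<eta> (g p) = S p" if "p \<in> I" for p
    using that g by (simp add: \<eta>_def)
  have all_\<eta>: "(\<forall>k\<in>{1..m}. P (\<eta> k)) \<longleftrightarrow> (\<forall>p\<in>I. P (S p))" if "P (\<lambda>x. 0)" for P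
  proof
    assume "\<forall>k\<in>{1..m}. P (\<eta> k)"
    then show "\<forall>p\<in>I. P (S p)" using g by (metis \<eta>_g image_subset_iff)
  next
    assume "\<forall>p\<in>I. P (S p)"
    with that show "\<forall>k\<in>{1..m}. P (\<eta> k)" by (simp add: \<eta>_def inv_into_into)
  qed
  have anti: "antisymmetric_function (S p)" and cont: "continuous_on UNIV (S p)" for p
    by (cases p; simp add: S_def antisymmetric_sorted_coord[OF e] continuous_sorted_coord)+
  have S_nonzero: "\<exists>t\<in>{1..?L}. inj (moment_proj h t x)" if p: "p \<in> I" "S p x \<noteq> 0" for p x
  proof -
    obtain t k c where tkc: "p = (t, k, c)" by (cases p)
    then have "t \<in> {1..?L}" using p(1) by (simp add: I_def)
    moreover have "inj (moment_proj h t x)"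
      using p(2) tkc sorted_coord_not_inj[of h t x e c\<^sub>0 k c] by (auto simp: S_def)
    ultimately show ?thesis by blast
  qed
  have zero_iff: "(\<forall>p\<in>I. S p x = 0) \<longleftrightarrow> (\<exists>i j. i \<noteq> j \<and> x $ i = x $ j)" for x
  proof
    assume 0: "\<forall>p\<in>I. S p x = 0"
    show "\<exists>i j. i \<noteq> j \<and> x $ i = x $ j"
    proof (rule ccontr)
      assume "\<not> ?thesis"
      then have "inj (($) x)" by (auto simp: inj_def)
      then obtain t where t: "t \<in> {1..?L}" "inj (moment_proj h t x)"
        using exists_inj_moment_proj[OF h] by blast
      with card have "(t, CARD('n) - 1, c\<^sub>0) \<in> I" by (simp add: I_def)
      with 0 have "sorted_coord e h c\<^sub>0 t (CARD('n) - 1) c\<^sub>0 x = 0"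
        by (auto simp: S_def)
      with t(2) show False
        by (auto simp: sorted_coord_def gap_prod_eq_0_iff)
    qed
  next
    assume "\<exists>i j. i \<noteq> j \<and> x $ i = x $ j"
    then obtain i j where "i \<noteq> j" "x $ i = x $ j" by blast
    then have "\<not> inj (moment_proj h t x)" for t
      using injD[of "moment_proj h t x" i j] by (auto simp: moment_proj_def)
    with S_nonzero show "\<forall>p\<in>I. S p x = 0" by blast
  qed
  have recover: "\<exists>\<sigma>. \<sigma> permutes UNIV \<and> x' = (\<chi> i. x $ \<sigma> i)"
    if eq: "\<forall>p\<in>I. S p x = S p x'" and nz: "\<not> (\<forall>p\<in>I. S p x = 0)" for x x'
  proof -
    obtain t where t: "t \<in> {1..?L}" "inj (moment_proj h t x)"
      using nz S_nonzero by blast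
    show ?thesis
    proof (rule sorted_coord_determines[OF card _ _ t(2)])
      show "t \<ge> 1" using t(1) by simp
      show "sorted_coord e h c\<^sub>0 t k c x = sorted_coord e h c\<^sub>0 t k c x'" if "k < CARD('n)" for k c
        using bspec[OF eq, of "(t, k, c)"] t(1) that by (simp add: I_def S_def)
    qed
  qed
  have \<eta>_anti: "\<forall>k\<in>{1..m}. antisymmetric_function (\<eta> k) \<and> continuous_on UNIV (\<eta> k)"
    by (subst all_\<eta>[where P = "\<lambda>f. antisymmetric_function f \<and> continuous_on UNIV f"])
       (simp_all add: anti cont antisymmetric_function_def[of "\<lambda>x. 0"])
  have \<eta>_zero: "(\<forall>k\<in>{1..m}. \<eta> k x = 0) \<longleftrightarrow> (\<exists>i j. i \<noteq> j \<and> x $ i = x $ j)" for x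
    using all_\<eta>[of "\<lambda>f. f x = 0"] zero_iff by simp
  have \<eta>_recover: "\<exists>\<sigma>. \<sigma> permutes UNIV \<and> x' = (\<chi> i. x $ \<sigma> i)"
    if "\<forall>k\<in>{1..m}. \<eta> k x = \<eta> k x'" "\<not> (\<forall>k\<in>{1..m}. \<eta> k x = 0)" for x x'
  proof (rule recover)
    show "\<forall>p\<in>I. S p x = S p x'"
      using that(1) all_\<eta>[of "\<lambda>f. f x = f x'"] by blast
    show "\<not> (\<forall>p\<in>I. S p x = 0)"
      using that(2) all_\<eta>[of "\<lambda>f. f x = 0"] by blast
  qed
  show ?thesis
  proof (intro exI[of _ \<eta>] conjI[OF \<eta>_anti] conjI allI impI)
    show "(\<forall>k\<in>{1..m}. \<eta> k x = 0) \<longleftrightarrow> (\<exists>i j. i \<noteq> j \<and> x $ i = x $ j)" for x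
      by (rule \<eta>_zero)
    show "\<exists>\<sigma>. \<sigma> permutes UNIV \<and> x' = (\<chi> i. x $ \<sigma> i)"
      if "(\<forall>k\<in>{1..m}. \<eta> k x = \<eta> k x') \<and> \<not> (\<forall>k\<in>{1..m}. \<eta> k x = 0)" for x x'
      using \<eta>_recover[OF conjunct1[OF that] conjunct2[OF that]] .
  qed
qed

end
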